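(* Let $S=\{z\in\mathbb{C}:|z|=1\}$. Any $C^\infty$ function $f:S\to\mathbb{C}$ is the difference $f=f_1-f_2$ of two $C^\infty$ functions $f_1,f_2:S\to\mathbb{C}$ whose graphs $\Gamma_{f_i}=\{(z,f_i(z))\in\mathbb{C}^2:z\in S\}$, $i=1,2$, are pluripolar in $\mathbb{C}^2$.
   Context: A set $K\subset\mathbb{C}^n$ is pluripolar if there is a plurisubharmonic function $u\not\equiv-\infty$ on $\mathbb{C}^n$ which is equal to $-\infty$ on $K$. *)

theory Defs
  imports "HOL-Analysis.Analysis"
begin

definition upper_semicontinuous :: "('a::topological_space \<Rightarrow> ereal) \<Rightarrow> bool" where
  "upper_semicontinuous u \<longleftrightarrow> (\<forall>c. open {x. u x < c})"

text \<open>
  The mean over \<open>[0, 2 * pi]\<close> of an extended real function, as the integral of its positive part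
  minus the integral of its negative part (\<open>e2ennreal\<close> sends negative arguments to \<open>0\<close>).
  It is used only for functions that are bounded above, so that \<open>\<infinity> - \<infinity>\<close> does not occur;
  the value \<open>-\<infinity>\<close> is possible.
\<close>

definition circle_mean :: "(real \<Rightarrow> ereal) \<Rightarrow> ereal" where
  "circle_mean g =
     (enn2ereal (\<integral>\<^sup>+t\<in>{0..2*pi}. e2ennreal (g t) \<partial>lborel)
      - enn2ereal (\<integral>\<^sup>+t\<in>{0..2*pi}. e2ennreal (- g t) \<partial>lborel)) / ereal (2 * pi)"

text \<open>Subharmonic functions on the complex plane; the constant \<open>-\<infinity>\<close> is allowed.\<close>

definition subharmonic :: "(complex \<Rightarrow> ereal) \<Rightarrow> bool" where
  "subharmonic u \<longleftrightarrow>
     (\<forall>z. u z \<noteq> \<infinity>) \<and> upper_semicontinuous u \<and>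
     (\<forall>z r. 0 < r \<longrightarrow> u z \<le> circle_mean (\<lambda>t. u (z + of_real r * cis t)))"

definition plurisubharmonic :: "(complex ^ 'n \<Rightarrow> ereal) \<Rightarrow> bool" where
  "plurisubharmonic u \<longleftrightarrow>
     (\<forall>x. u x \<noteq> \<infinity>) \<and> upper_semicontinuous u \<and>
     (\<forall>a b. subharmonic (\<lambda>\<zeta>. u (a + \<zeta> *s b)))"

definition pluripolar :: "(complex ^ 'n) set \<Rightarrow> bool" where
  "pluripolar K \<longleftrightarrow>
     (\<exists>u. plurisubharmonic u \<and> (\<exists>x. u x \<noteq> -\<infinity>) \<and> (\<forall>x\<in>K. u x = -\<infinity>))"

definition smooth_real :: "(real \<Rightarrow> complex) \<Rightarrow> bool" where
  "smooth_real g \<longleftrightarrow>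
     (\<exists>D :: nat \<Rightarrow> real \<Rightarrow> complex. D 0 = g \<and>
        (\<forall>k t. (D k has_vector_derivative D (Suc k) t) (at t)))"

text \<open>
  Smoothness of a function on the unit circle (as a one-dimensional manifold), expressed in the
  charts given by restrictions of the local diffeomorphism \<open>t \<mapsto> cis t\<close>. Only the values of
  \<open>f\<close> on the circle matter.
\<close>

definition smooth_on_circle :: "(complex \<Rightarrow> complex) \<Rightarrow> bool" where
  "smooth_on_circle f \<longleftrightarrow> smooth_real (\<lambda>t. f (cis t))"

definition circle_graph :: "(complex \<Rightarrow> complex) \<Rightarrow> (complex ^ 2) set" where
  "circle_graph f = {vector [z, f z] | z. z \<in> sphere 0 1}"

end

theory Submission
  imports Defs "HOL-Complex_Analysis.Complex_Analysis"
begin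

text \<open>
  For a polynomial \<open>P\<close> of degree \<open>d\<close>, the function \<open>ln \<bar>P\<bar> / d\<close> is plurisubharmonic with a growth that
  does not depend on \<open>d\<close>. Hence a function on the circle that is approximated by trigonometric
  polynomials \<open>T\<close>, with errors tiny compared with the degree and the coefficients of \<open>T\<close>, has a
  pluripolar graph: sum the functions belonging to \<open>P(z, w) = z\<^sup>N (w - T(z))\<close>, with \<open>T(z)\<close> written
  as a Laurent polynomial.

  Trigonometric polynomials are dense among the smooth functions on the circle, so one can choose
  \<open>S\<^sub>0, S\<^sub>1, \<dots>\<close> such that \<open>S\<^sub>m + S\<^sub>m\<^sub>-\<^sub>1\<close> approximates the given function \<open>f\<close> with its derivatives up to
  order \<open>m\<close>, with an error as small as we like in terms of \<open>S\<^sub>m\<^sub>-\<^sub>1\<close>. Then \<open>S\<^sub>m\<^sub>+\<^sub>1 - S\<^sub>m\<^sub>-\<^sub>1\<close> is tiny as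
  well, and \<open>f = lim S\<^sub>2\<^sub>j\<^sub>+\<^sub>1 - lim (- S\<^sub>2\<^sub>j)\<close> is the required decomposition.
\<close>

subsection \<open>Continuous plurisubharmonic functions\<close>

text \<open>Positive parts decrease from an integrable function and negative parts increase, so
  monotone convergence applies to the two integrals separately. The first limit is finite, hence the
  difference passes to the limit and keeps the lower bound, without knowing beforehand that the
  second limit is finite.\<close>

lemma circle_mean_INF_ge:
  fixes g :: "nat \<Rightarrow> real \<Rightarrow> real"
  assumes cont: "\<And>n. continuous_on UNIV (g n)"
    and dec: "\<And>n t. g (Suc n) t \<le> g n t"
    and ge: "\<And>n. 2 * pi * c \<le> integral {0..2*pi} (g n)"
  shows "ereal c \<le> circle_mean (\<lambda>t. INF n. ereal (g n t))"
proof -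
  define I where "I = {0..2*pi}"
  have [measurable]: "I \<in> sets borel" by (simp add: I_def)
  have [measurable]: "g n \<in> borel_measurable borel" for n
    using cont by (rule borel_measurable_continuous_onI)
  have int: "(\<lambda>t. h (g n t)) integrable_on I" if "continuous_on UNIV h" for h :: "real \<Rightarrow> real" and n
    unfolding I_def using cont[of n] that
    by (intro integrable_continuous_real) (auto intro: continuous_on_compose2 continuous_on_subset)
  define p where "p n = integral I (\<lambda>t. max 0 (g n t))" for n
  define m where "m n = integral I (\<lambda>t. max 0 (- g n t))" for n
  have cmax: "continuous_on UNIV (\<lambda>x::real. max 0 x)" "continuous_on UNIV (\<lambda>x::real. max 0 (- x))"
    by (intro continuous_intros)+
  have nn: "(\<integral>\<^sup>+t\<in>I. ennreal (h (g n t)) \<partial>lborel) = ennreal (integral I (\<lambda>t. h (g n t)))"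
    if "continuous_on UNIV h" "\<And>x. 0 \<le> h x" for h :: "real \<Rightarrow> real" and n
  proof -
    have "(\<lambda>t. h (g n t)) \<in> borel_measurable borel"
      using borel_measurable_continuous_onI[OF that(1)] by measurable
    moreover have "((\<lambda>t. h (g n t)) has_integral integral I (\<lambda>t. h (g n t))) I"
      using int[OF that(1)] by blast
    ultimately show ?thesis
      using that(2) by (intro nn_integral_has_integral_lebesgue') auto
  qed
  have ennreal_pos_part: "ennreal (max 0 x) = ennreal x" for x
    by (auto simp: max_def ennreal_neg)
  have A: "(\<integral>\<^sup>+t\<in>I. e2ennreal (ereal (g n t)) \<partial>lborel) = ennreal (p n)" for n
    using nn[OF cmax(1), of n] by (simp add: p_def ennreal_pos_part)
  have B: "(\<integral>\<^sup>+t\<in>I. e2ennreal (- ereal (g n t)) \<partial>lborel) = ennreal (m n)" for n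
    using nn[OF cmax(2), of n] by (simp add: m_def ennreal_pos_part)
  have p0: "0 \<le> p n" and m0: "0 \<le> m n" for n
    unfolding p_def m_def using int[OF cmax(1), of n] int[OF cmax(2), of n]
    by (auto intro: integral_nonneg)
  have pm: "2 * pi * c \<le> p n - m n" for n
  proof -
    have "p n - m n = integral I (\<lambda>t. max 0 (g n t) - max 0 (- g n t))"
      unfolding p_def m_def using int[OF cmax(1), of n] int[OF cmax(2), of n]
      by (simp add: integral_diff)
    also have "(\<lambda>t. max 0 (g n t) - max 0 (- g n t)) = g n" by (auto simp: max_def)
    finally show ?thesis using ge[of n] by (simp add: I_def)
  qed
  have decg: "decseq (\<lambda>n. ereal (g n t))" for t
    using dec by (intro decseq_SucI) simp
  have lim: "(\<lambda>n. ereal (g n t)) \<longlonglongrightarrow> (INF n. ereal (g n t))" for t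
    by (rule LIMSEQ_INF[OF decg])
  \<comment> \<open>\<open>e2ennreal\<close> is continuous and monotone, so it commutes with the
    infimum of a decreasing sequence: both sides are limits of the same sequence.\<close>
  have ce: "e2ennreal (INF n. ereal (g n t)) = (INF n. e2ennreal (ereal (g n t)))" for t
  proof (rule LIMSEQ_unique)
    show "(\<lambda>n. e2ennreal (ereal (g n t))) \<longlonglongrightarrow> e2ennreal (INF n. ereal (g n t))"
      by (intro continuous_on_tendsto_compose[OF continuous_on_e2ennreal[of UNIV]] lim) auto
    show "(\<lambda>n. e2ennreal (ereal (g n t))) \<longlonglongrightarrow> (INF n. e2ennreal (ereal (g n t)))"
      using decg[of t] by (intro LIMSEQ_INF) (simp add: decseq_def e2ennreal_mono del: e2ennreal_ereal)
  qed
  have ce': "e2ennreal (- (INF n. ereal (g n t))) = (SUP n. e2ennreal (- ereal (g n t)))" for t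
  proof (rule LIMSEQ_unique)
    show "(\<lambda>n. e2ennreal (- ereal (g n t))) \<longlonglongrightarrow> e2ennreal (- (INF n. ereal (g n t)))"
      by (intro continuous_on_tendsto_compose[OF continuous_on_e2ennreal[of UNIV]] tendsto_uminus_ereal lim) auto
    show "(\<lambda>n. e2ennreal (- ereal (g n t))) \<longlonglongrightarrow> (SUP n. e2ennreal (- ereal (g n t)))"
    proof (rule LIMSEQ_SUP, rule incseq_SucI)
      show "e2ennreal (- ereal (g n t)) \<le> e2ennreal (- ereal (g (Suc n) t))" for n
        using dec[of n t] by (intro e2ennreal_mono) simp
    qed
  qed
  have PI: "(\<integral>\<^sup>+t\<in>I. e2ennreal (INF n. ereal (g n t)) \<partial>lborel) = (INF n. ennreal (p n))"
  proof -
    have "(\<integral>\<^sup>+t\<in>I. e2ennreal (INF n. ereal (g n t)) \<partial>lborel)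
        = (\<integral>\<^sup>+t. (INF n. e2ennreal (ereal (g n t)) * indicator I t) \<partial>lborel)"
      unfolding ce by (intro nn_integral_cong) (auto simp: indicator_def)
    also have "\<dots> = (INF n. \<integral>\<^sup>+t\<in>I. e2ennreal (ereal (g n t)) \<partial>lborel)"
    \<comment> \<open>Downward monotone convergence needs one finite integral; index 0 supplies
      it.\<close>
    proof (rule nn_integral_monotone_convergence_INF_AE[where i=0])
      show "AE t in lborel. e2ennreal (ereal (g (Suc n) t)) * indicator I t \<le> e2ennreal (ereal (g n t)) * indicator I t" for n
        using dec by (auto intro!: mult_right_mono e2ennreal_mono simp del: e2ennreal_ereal)
    qed (use A in auto)
    finally show ?thesis using A by simp
  qed
  have NI: "(\<integral>\<^sup>+t\<in>I. e2ennreal (- (INF n. ereal (g n t))) \<partial>lborel) = (SUP n. ennreal (m n))"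
  proof -
    have "(\<integral>\<^sup>+t\<in>I. e2ennreal (- (INF n. ereal (g n t))) \<partial>lborel)
        = (\<integral>\<^sup>+t. (SUP n. e2ennreal (- ereal (g n t)) * indicator I t) \<partial>lborel)"
      unfolding ce' by (intro nn_integral_cong) (auto simp: indicator_def)
    also have "\<dots> = (SUP n. \<integral>\<^sup>+t\<in>I. e2ennreal (- ereal (g n t)) \<partial>lborel)"
    proof (rule nn_integral_monotone_convergence_SUP_AE)
      show "AE t in lborel. e2ennreal (- ereal (g n t)) * indicator I t \<le> e2ennreal (- ereal (g (Suc n) t)) * indicator I t" for n
        using dec by (intro AE_I2 mult_right_mono e2ennreal_mono) auto
    qed measurable
    finally show ?thesis using B by simp
  qed
  have pdec: "decseq (\<lambda>n. ennreal (p n))"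
  proof (rule decseq_SucI)
    show "ennreal (p (Suc n)) \<le> ennreal (p n)" for n
      unfolding p_def using dec int[OF cmax(1)]
      by (intro ennreal_leI integral_le) (auto simp: max_def intro: order_trans)
  qed
  have minc: "incseq (\<lambda>n. ennreal (m n))"
  proof (rule incseq_SucI)
    show "ennreal (m n) \<le> ennreal (m (Suc n))" for n
    proof -
      have "max 0 (- g n t) \<le> max 0 (- g (Suc n) t)" for t using dec[of n t] by auto
      then show ?thesis unfolding m_def using int[OF cmax(2)]
        by (intro ennreal_leI integral_le) auto
    qed
  qed
  let ?P = "enn2ereal (INF n. ennreal (p n))" and ?M = "enn2ereal (SUP n. ennreal (m n))"
  have limP: "(\<lambda>n. ereal (p n)) \<longlonglongrightarrow> ?P"
    using tendsto_enn2erealI[OF LIMSEQ_INF[OF pdec]] p0 by (simp add: enn2ereal_ennreal)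
  have limM: "(\<lambda>n. ereal (m n)) \<longlonglongrightarrow> ?M"
    using tendsto_enn2erealI[OF LIMSEQ_SUP[OF minc]] m0 by (simp add: enn2ereal_ennreal)
  have "?P \<le> enn2ereal (ennreal (p 0))"
    unfolding less_eq_ennreal.rep_eq[symmetric] by (rule INF_lower) simp
  then have "?P \<le> ereal (p 0)" "0 \<le> ?P" using p0 by (simp_all add: enn2ereal_ennreal)
  then have Pfin: "\<bar>?P\<bar> \<noteq> \<infinity>" by (cases ?P) auto
  have "(\<lambda>n. ereal (p n) - ereal (m n)) \<longlonglongrightarrow> ?P - ?M"
    using Pfin by (intro tendsto_diff_ereal_general limP limM) auto
  then have "ereal (2 * pi * c) \<le> ?P - ?M"
    by (rule LIMSEQ_le_const) (use pm in auto)
  then have "ereal c \<le> (?P - ?M) / ereal (2 * pi)"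
    by (subst ereal_le_divide_pos) (auto simp: mult_ac)
  then show ?thesis
    unfolding circle_mean_def using PI NI by (simp add: I_def)
qed

text \<open>Finite values and an ordinary integral make sums and multiples easy. The unit circle is
  enough, since scaling \<open>b\<close> produces every radius.\<close>

definition cont_psh :: "(complex ^ 'n \<Rightarrow> real) \<Rightarrow> bool" where
  "cont_psh v \<longleftrightarrow> continuous_on UNIV v \<and>
     (\<forall>a b. 2 * pi * v a \<le> integral {0..2*pi} (\<lambda>t. v (a + cis t *s b)))"

lemma continuous_on_circle_line:
  fixes v :: "complex ^ 'n \<Rightarrow> 'a::topological_space"
  assumes "continuous_on UNIV v"
  shows "continuous_on S (\<lambda>t. v (a + cis t *s b))"
proof -
  have "continuous_on S (\<lambda>t. cis t *s b)"
    unfolding vector_scalar_mult_def by (intro continuous_intros)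
  then show ?thesis
    by (intro continuous_on_compose2[OF assms] continuous_intros) auto
qed

text \<open>Sublevel sets of the infimum are unions of open sublevel sets. The mean value inequality
  follows by monotone convergence where the infimum is finite and is trivial where it is
  \<open>-\<infinity>\<close>.\<close>

lemma plurisubharmonic_INF:
  fixes v :: "nat \<Rightarrow> complex ^ 'n \<Rightarrow> real"
  assumes psh: "\<And>n. cont_psh (v n)" and dec: "\<And>n x. v (Suc n) x \<le> v n x"
  shows "plurisubharmonic (\<lambda>x. INF n. ereal (v n x))"
proof -
  define u where "u x = (INF n. ereal (v n x))" for x
  have cont: "continuous_on UNIV (v n)" for n
    using psh by (simp add: cont_psh_def)
  have fin: "u x \<noteq> \<infinity>" for x
  proof -
    have "u x \<le> ereal (v 0 x)" unfolding u_def by (rule INF_lower) simp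
    then show ?thesis by auto
  qed
  \<comment> \<open>Composing with an arbitrary continuous map covers both \<open>u\<close> and its
    restrictions to complex lines.\<close>
  have usc: "upper_semicontinuous (\<lambda>z. u (h z))" if h: "continuous_on UNIV h"
    for h :: "'a::topological_space \<Rightarrow> complex ^ 'n"
    unfolding upper_semicontinuous_def
  proof
    fix c
    have "{z. u (h z) < c} = (\<Union>n. {z. ereal (v n (h z)) < c})"
      by (auto simp: u_def INF_less_iff)
    also have "open \<dots>"
      by (intro open_UN ballI open_Collect_less continuous_intros continuous_on_ereal
          continuous_on_compose2[OF cont h]) auto
    finally show "open {z. u (h z) < c}" .
  qed
  have "subharmonic (\<lambda>\<zeta>. u (a + \<zeta> *s b))" for a b
    unfolding subharmonic_def
  proof (intro conjI allI impI)
    show "u (a + \<zeta> *s b) \<noteq> \<infinity>" for \<zeta> by (rule fin)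
    show "upper_semicontinuous (\<lambda>\<zeta>. u (a + \<zeta> *s b))"
      unfolding vector_scalar_mult_def by (intro usc continuous_intros)
    fix z and r :: real assume "0 < r"
    \<comment> \<open>Centre and radius move into base point and direction, which leaves the unit
      circle of \<open>cont_psh\<close>.\<close>
    define a' b' where "a' = a + z *s b" and "b' = of_real r *s b"
    have eq: "a + (z + of_real r * cis t) *s b = a' + cis t *s b'" for t
      by (simp add: a'_def b'_def vec_eq_iff algebra_simps)
    have "u a' \<le> circle_mean (\<lambda>t. u (a' + cis t *s b'))"
    proof (cases "u a'")
      case (real c)
      have "c \<le> v n a'" for n
        using real INF_lower[of n UNIV "\<lambda>n. ereal (v n a')"] by (simp add: u_def)
      then have "2 * pi * c \<le> integral {0..2*pi} (\<lambda>t. v n (a' + cis t *s b'))" for n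
        using psh[of n] unfolding cont_psh_def
        by (meson mult_left_mono order_trans pi_ge_zero mult_nonneg_nonneg zero_le_numeral)
      then show ?thesis
        unfolding u_def real[unfolded u_def]
        by (intro circle_mean_INF_ge continuous_on_circle_line cont dec)
    qed (use fin in auto)
    then show "u (a + z *s b) \<le> circle_mean (\<lambda>t. u (a + (z + of_real r * cis t) *s b))"
      unfolding eq by (simp add: a'_def)
  qed
  moreover have "upper_semicontinuous u" using usc[of id] by (simp add: id_def)
  ultimately show ?thesis
    unfolding plurisubharmonic_def u_def[abs_def, symmetric] using fin by auto
qed

lemma cont_psh_add: "cont_psh u \<Longrightarrow> cont_psh v \<Longrightarrow> cont_psh (\<lambda>x. u x + v x)"
proof -
  assume uv: "cont_psh u" "cont_psh v"
  then have c: "continuous_on UNIV u" "continuous_on UNIV v" by (auto simp: cont_psh_def)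
  have "2 * pi * (u a + v a) \<le> integral {0..2*pi} (\<lambda>t. u (a + cis t *s b) + v (a + cis t *s b))" for a b
  proof -
    have "(\<lambda>t. u (a + cis t *s b)) integrable_on {0..2*pi}" "(\<lambda>t. v (a + cis t *s b)) integrable_on {0..2*pi}"
      by (intro integrable_continuous_real continuous_on_circle_line c)+
    then show ?thesis
      using uv by (simp add: integral_add cont_psh_def algebra_simps add_mono)
  qed
  with c show ?thesis by (auto simp: cont_psh_def intro: continuous_on_add)
qed

lemma cont_psh_cmult: "cont_psh u \<Longrightarrow> 0 \<le> k \<Longrightarrow> cont_psh (\<lambda>x. k * u x)"
  unfolding cont_psh_def
  by (auto intro!: continuous_intros simp: mult.left_commute[of "2 * pi"] mult_left_mono)

lemma cont_psh_const: "cont_psh (\<lambda>x. k)"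
  by (simp add: cont_psh_def)

lemma cont_psh_sum:
  "finite A \<Longrightarrow> (\<And>j. j \<in> A \<Longrightarrow> cont_psh (f j)) \<Longrightarrow> cont_psh (\<lambda>x. \<Sum>j\<in>A. f j x)"
  by (induction A rule: finite_induct) (auto intro: cont_psh_add cont_psh_const)

subsection \<open>Jensen's inequality\<close>

text \<open>Cutting [0, a + p] at \<open>a\<close> and at \<open>p\<close> leaves the pieces [0, a]
  and [p, a + p], which a shift by one period identifies.\<close>

lemma integral_periodic:
  fixes f :: "real \<Rightarrow> real"
  assumes cont: "continuous_on UNIV f" and per: "\<And>t. f (t + p) = f t" and "0 \<le> a" "0 \<le> p"
  shows "integral {a..a+p} f = integral {0..p} f"
proof -
  have int: "f integrable_on {x..y}" for x y
    by (intro integrable_continuous_real continuous_on_subset[OF cont]) auto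
  have "integral {0..a} f + integral {a..a+p} f = integral {0..a+p} f"
    by (rule Henstock_Kurzweil_Integration.integral_combine) (use assms int in auto)
  moreover have "integral {0..p} f + integral {p..a+p} f = integral {0..a+p} f"
    by (rule Henstock_Kurzweil_Integration.integral_combine) (use assms int in auto)
  moreover have "integral {0..a} (f \<circ> (\<lambda>x. x + p)) = integral {0+p..a+p} f"
    by (intro integral_shift continuous_on_subset[OF cont]) auto
  ultimately show ?thesis by (simp add: o_def per)
qed

lemma cis_Arg2pi: "norm z = 1 \<Longrightarrow> cis (Arg2pi z) = z"
  using Arg2pi_eq[of z] by (simp add: cis_conv_exp)

text \<open>
  Jensen's inequality without logarithms of holomorphic functions: apply the maximum principle to
  \<open>\<Prod>k<N. g (cis (2 * pi * k / N) * z)\<close>, whose value at the origin is \<open>g 0 ^ N\<close>; on the circle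
  the logarithm of its modulus is a Riemann sum of the integral.
\<close>

lemma ln_max_norm_le_mean:
  fixes g :: "complex \<Rightarrow> complex"
  assumes hol: "g holomorphic_on UNIV" and "0 < d"
  shows "2 * pi * ln (max (norm (g 0)) d) \<le> integral {0..2*pi} (\<lambda>t. ln (max (norm (g (cis t))) d))"
proof -
  define L where "L t = ln (max (norm (g (cis t))) d)" for t
  have contg: "continuous_on UNIV g" using hol by (rule holomorphic_on_imp_continuous_on)
  have cL: "continuous_on S L" for S
    unfolding L_def using \<open>0 < d\<close>
    by (intro continuous_intros continuous_on_compose2[OF contg]) (auto simp: max_def)
  have int: "L integrable_on {x..y}" for x y
    by (intro integrable_continuous_real cL)
  have per: "L (t + 2*pi) = L t" for t by (simp add: L_def cis_mult[symmetric])
  show ?thesis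
  proof (cases "norm (g 0) \<le> d")
    case True
    have "2 * pi * ln d = integral {0..2*pi} (\<lambda>t. ln d)" by simp
    also have "\<dots> \<le> integral {0..2*pi} L"
      using \<open>0 < d\<close> by (intro integral_le int) (auto simp: L_def)
    finally show ?thesis using True by (simp add: L_def[abs_def] max_def)
  next
    case False
    have "ln (norm (g 0)) * (2 * pi) \<le> integral {0..2*pi} L + e" if "0 < e" for e
    proof -
      define e' where "e' = e / (2 * pi)"
      have "0 < e'" using that by (simp add: e'_def)
      \<comment> \<open>The partition below starts at an angle of at most 2 pi and runs over one
        full period, so it stays below 4 pi.\<close>
      have "uniformly_continuous_on {0..4*pi} L"
        by (intro compact_uniformly_continuous cL) auto
      then obtain \<eta> where \<eta>: "0 < \<eta>"
        "\<And>s t. s \<in> {0..4*pi} \<Longrightarrow> t \<in> {0..4*pi} \<Longrightarrow> \<bar>s - t\<bar> < \<eta> \<Longrightarrow> \<bar>L s - L t\<bar> < e'"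
        using \<open>0 < e'\<close> unfolding uniformly_continuous_on_def dist_real_def
        by (metis abs_minus_commute)
      obtain N :: nat where "2 * pi / \<eta> < real N" using reals_Archimedean2 by blast
      moreover have "0 < 2 * pi / \<eta>" using \<eta> by simp
      ultimately have "0 < N" by (cases N) auto
      then have N: "0 < N" "2 * pi / real N < \<eta>"
        using \<open>2 * pi / \<eta> < real N\<close> \<eta>(1) by (auto simp: field_simps)
      define h where "h = 2 * pi / real N"
      have h: "0 < h" "h < \<eta>" "real N * h = 2 * pi" using N by (auto simp: h_def)
      define G where "G z = (\<Prod>k<N. g (cis (real k * h) * z))" for z
      have G: "G holomorphic_on S" for S
      proof -
        have "(g \<circ> (\<lambda>z. cis (real k * h) * z)) holomorphic_on S" for k
          by (intro holomorphic_on_compose holomorphic_intros holomorphic_on_subset[OF hol]) auto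
        then show ?thesis unfolding G_def by (intro holomorphic_intros) (simp add: o_def)
      qed
      have "continuous_on (sphere 0 1) (\<lambda>z. norm (G z))"
        by (intro continuous_intros holomorphic_on_imp_continuous_on G)
      then have "\<exists>z\<in>sphere 0 1. \<forall>y\<in>sphere 0 1. norm (G y) \<le> norm (G z)"
        by (intro continuous_attains_sup) (auto simp: sphere_eq_empty)
      then obtain z where z: "z \<in> sphere 0 1" "\<And>y. y \<in> sphere 0 1 \<Longrightarrow> norm (G y) \<le> norm (G z)"
        by blast
      \<comment> \<open>The maximum principle yields some rotation of the partition that works; the
        angle of \<open>z\<close> becomes its first node.\<close>
      have "norm (G 0) \<le> norm (G z)"
        by (rule maximum_modulus_frontier[of G "cball 0 1"])
          (auto intro!: holomorphic_on_imp_continuous_on G z(2) simp: dist_norm norm_minus_commute)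
      define \<theta> where "\<theta> = Arg2pi z"
      have \<theta>: "cis \<theta> = z" "0 \<le> \<theta>" "\<theta> \<le> 2 * pi"
        using z cis_Arg2pi[of z] Arg2pi_ge_0[of z] Arg2pi_lt_2pi[of z] by (auto simp: \<theta>_def)
      have "G 0 = g 0 ^ N" by (simp add: G_def)
      moreover have "G z = (\<Prod>k<N. g (cis (\<theta> + real k * h)))"
        unfolding G_def \<theta>(1)[symmetric] cis_mult by (simp add: add.commute)
      ultimately have *: "norm (g 0) ^ N \<le> (\<Prod>k<N. norm (g (cis (\<theta> + real k * h))))"
        using \<open>norm (G 0) \<le> norm (G z)\<close> by (simp add: norm_power prod_norm)
      have g0: "0 < norm (g 0)" using False \<open>0 < d\<close> by linarith
      have "real N * ln (norm (g 0)) = ln (norm (g 0) ^ N)" using g0 by (simp add: ln_realpow)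
      \<comment> \<open>Truncation makes every factor positive, so that the logarithm of the product
        splits into a sum.\<close>
      also have "\<dots> \<le> ln (\<Prod>k<N. max (norm (g (cis (\<theta> + real k * h)))) d)"
      proof -
        have "(\<Prod>k<N. norm (g (cis (\<theta> + real k * h)))) \<le> (\<Prod>k<N. max (norm (g (cis (\<theta> + real k * h)))) d)"
          by (intro prod_mono) auto
        with * g0 show ?thesis by (smt (verit) ln_mono zero_less_power)
      qed
      also have "\<dots> = (\<Sum>k<N. L (\<theta> + real k * h))"
        unfolding L_def using \<open>0 < d\<close> by (intro ln_prod) (auto simp: less_max_iff_disj)
      finally have "h * (real N * ln (norm (g 0))) \<le> h * (\<Sum>k<N. L (\<theta> + real k * h))"
        using h by (intro mult_left_mono) auto
      then have 1: "2 * pi * ln (norm (g 0)) \<le> (\<Sum>k<N. h * L (\<theta> + real k * h))"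
        unfolding h(3)[symmetric] by (simp add: sum_distrib_left mult_ac)
      \<comment> \<open>By uniform continuity the rectangle over a step of width \<open>h\<close>
        exceeds the integral over that step by at most \<open>e' * h\<close>; induction adds up the
        steps.\<close>
      have "(\<Sum>k<n. h * L (\<theta> + real k * h)) \<le> integral {\<theta>..\<theta> + real n * h} (\<lambda>t. L t + e')" if "n \<le> N" for n
        using that
      proof (induction n)
        case (Suc n)
        let ?a = "\<theta> + real n * h" and ?b = "\<theta> + real (Suc n) * h"
        have ab: "?b = ?a + h" by (simp add: algebra_simps)
        have "real (Suc n) * h \<le> 2 * pi"
          using Suc.prems h by (metis mult_right_mono of_nat_le_iff less_imp_le)
        then have bnd: "0 \<le> ?a" "?b \<le> 4 * pi"
          using \<theta> h by auto
        have "h * L ?a = integral {?a..?b} (\<lambda>t. L ?a)"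
          using h unfolding ab by simp
        also have "\<dots> \<le> integral {?a..?b} (\<lambda>t. L t + e')"
        proof (intro integral_le integrable_add int)
          fix t assume t: "t \<in> {?a..?b}"
          have "\<bar>L ?a - L t\<bar> < e'"
            using t bnd h ab by (intro \<eta>(2)) auto
          then show "L ?a \<le> L t + e'" by linarith
        qed auto
        finally have "(\<Sum>k<Suc n. h * L (\<theta> + real k * h))
            \<le> integral {\<theta>..?a} (\<lambda>t. L t + e') + integral {?a..?b} (\<lambda>t. L t + e')"
          using Suc by auto
        also have "\<dots> = integral {\<theta>..?b} (\<lambda>t. L t + e')"
          using h \<theta> unfolding ab by (intro Henstock_Kurzweil_Integration.integral_combine integrable_add int) auto
        finally show ?case .
      qed simp
      from this[OF order_refl] 1
      have "2 * pi * ln (norm (g 0)) \<le> integral {\<theta>..\<theta> + 2 * pi} (\<lambda>t. L t + e')"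
        using h(3) by simp
      also have "\<dots> = integral {0..2*pi} L + e"
        using \<theta> by (subst integral_add[OF int]) (auto simp: e'_def integral_periodic[OF cL per])
      finally show ?thesis by (simp add: mult_ac)
    qed
    then have "ln (norm (g 0)) * (2 * pi) \<le> integral {0..2*pi} L" by (rule field_le_epsilon)
    then show ?thesis using False by (simp add: L_def[abs_def] max_def mult_ac)
  qed
qed

text \<open>Truncation at \<open>ln d\<close> keeps the logarithm finite and continuous; on each
  complex line the claim is Jensen's inequality.\<close>

lemma cont_psh_ln_max_norm:
  fixes F :: "complex ^ 'n \<Rightarrow> complex"
  assumes "continuous_on UNIV F" and hol: "\<And>a b. (\<lambda>\<zeta>. F (a + \<zeta> *s b)) holomorphic_on UNIV"
    and "0 < d"
  shows "cont_psh (\<lambda>x. ln (max (norm (F x)) d))"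
  unfolding cont_psh_def
proof (intro conjI allI)
  show "continuous_on UNIV (\<lambda>x. ln (max (norm (F x)) d))"
    using assms by (intro continuous_intros) (auto simp: max_def)
  show "2 * pi * ln (max (norm (F a)) d) \<le> integral {0..2 * pi} (\<lambda>t. ln (max (norm (F (a + cis t *s b))) d))" for a b
    using ln_max_norm_le_mean[OF hol[of a b] \<open>0 < d\<close>] by simp
qed

subsection \<open>Smooth functions on the circle and trigonometric polynomials\<close>

definition vderiv :: "(real \<Rightarrow> complex) \<Rightarrow> real \<Rightarrow> complex" where
  "vderiv g t = vector_derivative g (at t)"

lemma vderiv_eqI: "(\<And>t. (g has_vector_derivative g' t) (at t)) \<Longrightarrow> vderiv g = g'"
  by (rule ext) (auto simp: vderiv_def intro: vector_derivative_at)

text \<open>Derivatives are unique, so every sequence witnessing smoothness consists of the iterates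
  of \<open>vderiv\<close>. Higher derivatives thus get a name without choosing a witness.\<close>

lemma funpow_vderiv_eqI:
  assumes "D 0 = g" "\<And>k t. (D k has_vector_derivative D (Suc k) t) (at t)"
  shows "(vderiv ^^ k) g = D k"
  by (induction k) (auto simp: assms intro: vderiv_eqI)

lemma smooth_realI:
  assumes "D 0 = g" "\<And>k t. (D k has_vector_derivative D (Suc k) t) (at t)"
  shows "smooth_real g"
  using assms unfolding smooth_real_def by blast

lemma smooth_real_funpow_vderiv:
  assumes "smooth_real g"
  shows "((vderiv ^^ k) g has_vector_derivative (vderiv ^^ Suc k) g t) (at t)"
proof -
  obtain D where D: "D 0 = g" "\<And>k t. (D k has_vector_derivative D (Suc k) t) (at t)"
    using assms by (auto simp: smooth_real_def)
  show ?thesis unfolding funpow_vderiv_eqI[of D, OF D] by (rule D)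
qed

lemma smooth_real_vderiv: "smooth_real g \<Longrightarrow> smooth_real (vderiv g)"
  by (rule smooth_realI[of "\<lambda>k. (vderiv ^^ Suc k) g"]) (simp, rule smooth_real_funpow_vderiv)

lemma smooth_real_imp_deriv:
  "smooth_real g \<Longrightarrow> (g has_vector_derivative vderiv g t) (at t)"
  using smooth_real_funpow_vderiv[of g 0 t] by simp

lemma smooth_real_continuous: "smooth_real g \<Longrightarrow> continuous_on S g"
  by (meson smooth_real_imp_deriv continuous_at_imp_continuous_on has_vector_derivative_continuous)

lemma
  assumes "smooth_real g" "smooth_real h"
  shows smooth_real_add: "smooth_real (\<lambda>t. g t + h t)"
    and funpow_vderiv_add: "(vderiv ^^ k) (\<lambda>t. g t + h t) = (\<lambda>t. (vderiv ^^ k) g t + (vderiv ^^ k) h t)"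
proof -
  let ?D = "\<lambda>k t. (vderiv ^^ k) g t + (vderiv ^^ k) h t"
  have D: "?D 0 = (\<lambda>t. g t + h t)" "\<And>k t. (?D k has_vector_derivative ?D (Suc k) t) (at t)"
    using assms by (auto intro!: has_vector_derivative_add smooth_real_funpow_vderiv simp del: funpow.simps(2))
  show "smooth_real (\<lambda>t. g t + h t)" by (rule smooth_realI[of ?D, OF D])
  show "(vderiv ^^ k) (\<lambda>t. g t + h t) = ?D k" by (rule funpow_vderiv_eqI[of ?D, OF D])
qed

lemma
  assumes "smooth_real g"
  shows smooth_real_minus: "smooth_real (\<lambda>t. - g t)"
    and funpow_vderiv_minus: "(vderiv ^^ k) (\<lambda>t. - g t) = (\<lambda>t. - (vderiv ^^ k) g t)"
proof -
  let ?D = "\<lambda>k t. - (vderiv ^^ k) g t"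
  have D: "?D 0 = (\<lambda>t. - g t)" "\<And>k t. (?D k has_vector_derivative ?D (Suc k) t) (at t)"
    using assms by (auto intro!: has_vector_derivative_minus smooth_real_funpow_vderiv simp del: funpow.simps(2))
  show "smooth_real (\<lambda>t. - g t)" by (rule smooth_realI[of ?D, OF D])
  show "(vderiv ^^ k) (\<lambda>t. - g t) = ?D k" by (rule funpow_vderiv_eqI[of ?D, OF D])
qed

lemma funpow_vderiv_diff:
  assumes "smooth_real g" "smooth_real h"
  shows "(vderiv ^^ k) (\<lambda>t. g t - h t) = (\<lambda>t. (vderiv ^^ k) g t - (vderiv ^^ k) h t)"
  using funpow_vderiv_add[OF assms(1) smooth_real_minus[OF assms(2)]]
  by (simp add: funpow_vderiv_minus[OF assms(2)])

section \<open>Trigonometric polynomials\<close>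

lemma has_vector_derivative_cis_mult:
  "((\<lambda>t. cis (r * t)) has_vector_derivative (\<i> * of_real r) * cis (r * t)) (at t within S)"
  unfolding has_vector_derivative_complex_iff
  by (auto intro!: derivative_eq_intros)

inductive trig_poly :: "(real \<Rightarrow> complex) \<Rightarrow> bool" where
  trig_poly_monom: "trig_poly (\<lambda>t. a * cis (of_int n * t))"
| trig_poly_add: "trig_poly S \<Longrightarrow> trig_poly T \<Longrightarrow> trig_poly (\<lambda>t. S t + T t)"

lemma trig_poly_const: "trig_poly (\<lambda>t. c)"
  using trig_poly_monom[of c 0] by simp

lemma trig_poly_mult: "trig_poly S \<Longrightarrow> trig_poly T \<Longrightarrow> trig_poly (\<lambda>t. S t * T t)"
proof (induction S rule: trig_poly.induct)
  case (trig_poly_monom a n)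
  then show ?case
  proof (induction T rule: trig_poly.induct)
    case (trig_poly_monom b m)
    have "cis (of_int (n + m) * t) = cis (of_int n * t) * cis (of_int m * t)" for t
      by (simp only: cis_mult of_int_add distrib_right)
    then have "(\<lambda>t. a * cis (of_int n * t) * (b * cis (of_int m * t))) = (\<lambda>t. (a * b) * cis (of_int (n + m) * t))"
      by (simp add: mult_ac)
    then show ?case using trig_poly.trig_poly_monom by metis
  qed (auto simp: distrib_left intro: trig_poly.trig_poly_add)
qed (auto simp: distrib_right intro: trig_poly.trig_poly_add)

lemma trig_poly_minus: "trig_poly T \<Longrightarrow> trig_poly (\<lambda>t. - T t)"
  using trig_poly_mult[OF trig_poly_const[of "-1"]] by simp

lemma trig_poly_diff: "trig_poly S \<Longrightarrow> trig_poly T \<Longrightarrow> trig_poly (\<lambda>t. S t - T t)"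
  using trig_poly_add[OF _ trig_poly_minus] by simp

lemma trig_poly_smooth: "trig_poly T \<Longrightarrow> smooth_real T"
proof (induction rule: trig_poly.induct)
  case (trig_poly_monom a n)
  let ?D = "\<lambda>k t. (a * (\<i> * of_int n) ^ k) * cis (of_int n * t)"
  have "(?D k has_vector_derivative ?D (Suc k) t) (at t)" for k t
  proof -
    have eq: "?D (Suc k) t = a * (\<i> * of_int n) ^ k * (\<i> * of_real (of_int n) * cis (of_int n * t))"
      by simp
    show ?thesis
      unfolding eq by (intro has_vector_derivative_mult_right has_vector_derivative_cis_mult)
  qed
  then show ?case by (intro smooth_realI[of ?D]) auto
qed (rule smooth_real_add)

text \<open>The constant \<open>c\<close> collects the terms of frequency zero, the only ones that
  may lack a periodic primitive.\<close>

lemma trig_poly_antiderivative: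
  "trig_poly T \<Longrightarrow> \<exists>U c. trig_poly U \<and> (\<forall>t. (U has_vector_derivative T t - c) (at t))"
proof (induction rule: trig_poly.induct)
  case (trig_poly_monom a n)
  show ?case
  proof (cases "n = 0")
    case True
    have "((\<lambda>t. 0) has_vector_derivative a * cis (of_int n * t) - a) (at t)" for t
      using True by (auto intro!: derivative_eq_intros)
    then show ?thesis using trig_poly_const by blast
  next
    case False
    have "((\<lambda>t. a / (\<i> * of_int n) * cis (of_int n * t)) has_vector_derivative a * cis (of_int n * t) - 0) (at t)" for t
      using has_vector_derivative_mult_right[OF has_vector_derivative_cis_mult[of "of_int n" t UNIV], of "a / (\<i> * of_int n)"] False
      by simp
    then show ?thesis using trig_poly.trig_poly_monom by blast
  qed
next
  case (trig_poly_add S T)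
  then obtain U c V d where "trig_poly U" "\<And>t. (U has_vector_derivative S t - c) (at t)"
    "trig_poly V" "\<And>t. (V has_vector_derivative T t - d) (at t)" by blast
  then have "trig_poly (\<lambda>t. U t + V t)"
    "\<And>t. ((\<lambda>t. U t + V t) has_vector_derivative (S t + T t) - (c + d)) (at t)"
    by (auto intro!: trig_poly.trig_poly_add derivative_eq_intros)
  then show ?case by blast
qed

section \<open>Functions on the circle as periodic functions of the angle\<close>

definition circle_periodic :: "(real \<Rightarrow> complex) \<Rightarrow> bool" where
  "circle_periodic g \<longleftrightarrow> (\<forall>s t. cis s = cis t \<longrightarrow> g s = g t)"

lemma trig_poly_periodic: "trig_poly T \<Longrightarrow> circle_periodic T"
proof (induction rule: trig_poly.induct)
  case (trig_poly_monom a n)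
  have "cis (of_int n * t) = cis t powi n" for t by (simp add: cis_power_int)
  then show ?case by (simp add: circle_periodic_def)
next
  case (trig_poly_add S T)
  then show ?case
    unfolding circle_periodic_def by (intro allI impI arg_cong2[where f = "(+)"]) blast+
qed

text \<open>If \<open>cis s = cis t\<close>, translation by \<open>s - t\<close> leaves
  \<open>g\<close> unchanged and carries derivatives at \<open>t\<close> to derivatives at
  \<open>s\<close>.\<close>

lemma circle_periodic_vderiv:
  assumes "circle_periodic g" shows "circle_periodic (vderiv g)"
proof -
  have "(g has_vector_derivative y) (at s)" if st: "cis s = cis t" and d: "(g has_vector_derivative y) (at t)" for s t y
  proof -
    have "cis (x - (s - t)) = cis x" for x
      using st by (simp flip: cis_divide)
    then have "g (x - (s - t)) = g x" for x
      using assms unfolding circle_periodic_def by blast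
    moreover have "((g \<circ> (\<lambda>x. x - (s - t))) has_vector_derivative 1 *\<^sub>R y) (at s)"
      using d by (intro vector_diff_chain_at) (auto intro!: derivative_eq_intros)
    ultimately show ?thesis by (simp add: o_def)
  qed
  \<comment> \<open>\<open>vector_derivative\<close> is a choice from this predicate; equal
    predicates give equal values even where no derivative exists.\<close>
  then have "(\<lambda>y. (g has_vector_derivative y) (at s)) = (\<lambda>y. (g has_vector_derivative y) (at t))"
    if "cis s = cis t" for s t
    using that by metis
  then show ?thesis
    unfolding circle_periodic_def vderiv_def vector_derivative_def by metis
qed

text \<open>\<open>Arg2pi\<close> jumps at 1, so continuity is not that of a composition. Instead
  \<open>cis\<close> is a quotient map from the compact interval [0, 2 pi] onto the circle, and the
  function pulls back to \<open>g\<close> along it.\<close>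

lemma circle_periodic_continuous:
  assumes "circle_periodic g" "continuous_on UNIV g"
  shows "continuous_on (sphere 0 1) (\<lambda>z. g (Arg2pi z))"
proof -
  have g: "g (Arg2pi (cis t)) = g t" for t
    using assms(1) cis_Arg2pi[of "cis t"] unfolding circle_periodic_def by (metis norm_cis)
  have im: "cis ` {0..2*pi} = sphere 0 1"
  proof (intro subset_antisym subsetI)
    fix z :: complex assume "z \<in> sphere 0 1"
    then have "cis (Arg2pi z) = z" by (simp add: cis_Arg2pi)
    moreover have "Arg2pi z \<in> {0..2*pi}" using Arg2pi_ge_0[of z] Arg2pi_lt_2pi[of z] by simp
    ultimately show "z \<in> cis ` {0..2*pi}" by (metis image_eqI)
  qed auto
  have "openin (top_of_set (sphere 0 1)) (sphere 0 1 \<inter> (\<lambda>z. g (Arg2pi z)) -` U)" if "open U" for U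
  proof -
    have "openin (top_of_set {0..2*pi}) ({0..2*pi} \<inter> cis -` (sphere 0 1 \<inter> (\<lambda>z. g (Arg2pi z)) -` U))
      = openin (top_of_set (sphere 0 1)) (sphere 0 1 \<inter> (\<lambda>z. g (Arg2pi z)) -` U)"
      by (intro Abstract_Topology_2.continuous_imp_quotient_map) (auto intro!: continuous_intros simp: im)
    moreover have "{0..2*pi} \<inter> cis -` (sphere 0 1 \<inter> (\<lambda>z. g (Arg2pi z)) -` U) = {0..2*pi} \<inter> g -` U"
      by (auto simp: g)
    moreover have "openin (top_of_set {0..2*pi}) ({0..2*pi} \<inter> g -` U)"
      using that continuous_on_subset[OF assms(2)] continuous_openin_preimage_gen by blast
    ultimately show ?thesis by simp
  qed
  then show ?thesis by (subst continuous_on_open_gen[where T = UNIV]) auto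
qed

section \<open>Density of trigonometric polynomials\<close>

lemma trig_poly_real_polynomial_function:
  fixes p :: "complex \<Rightarrow> real"
  assumes "real_polynomial_function p"
  shows "trig_poly (\<lambda>t. of_real (p (cis t)))"
  using assms
proof (induction p rule: real_polynomial_function.induct)
  case (linear p)
  interpret p: bounded_linear p by fact
  have p: "p (cis t) = cos t * p 1 + sin t * p \<i>" for t
  proof -
    have "cis t = cos t *\<^sub>R 1 + sin t *\<^sub>R \<i>" by (simp add: complex_eq_iff)
    then show ?thesis by (metis p.add p.scaleR real_scaleR_def)
  qed
  \<comment> \<open>Euler's formulas for cosine and sine.\<close>
  have eq: "complex_of_real (p (cis t)) = (p 1 - \<i> * p \<i>) / 2 * cis (of_int 1 * t) + (p 1 + \<i> * p \<i>) / 2 * cis (of_int (- 1) * t)" for t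
    unfolding p by (simp add: complex_eq_iff field_simps)
  show ?case unfolding eq by (intro trig_poly.intros)
next
  case (const c)
  then show ?case by (rule trig_poly_const)
next
  case (add f g)
  then show ?case by (simp add: trig_poly_add)
next
  case (mult f g)
  then show ?case by (simp add: trig_poly_mult)
qed

lemma trig_poly_polynomial_function:
  fixes p :: "complex \<Rightarrow> complex"
  assumes "polynomial_function p"
  shows "trig_poly (\<lambda>t. p (cis t))"
proof -
  have "real_polynomial_function (Re \<circ> p)" "real_polynomial_function (Im \<circ> p)"
    using assms bounded_linear_Re bounded_linear_Im by (auto simp: polynomial_function_def)
  then have "trig_poly (\<lambda>t. of_real (Re (p (cis t))) + \<i> * of_real (Im (p (cis t))))"
    by (auto intro!: trig_poly_add trig_poly_mult trig_poly_const dest!: trig_poly_real_polynomial_function)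
  then show ?thesis by (simp add: complex_eq[symmetric])
qed

text \<open>Stone-Weierstrass on the unit circle, applied to \<open>g\<close> as a function of the
  point; a polynomial in real and imaginary part is a trigonometric polynomial in the angle.\<close>

lemma trig_poly_dense_uniform:
  assumes "circle_periodic g" "continuous_on UNIV g" "0 < e"
  shows "\<exists>T. trig_poly T \<and> (\<forall>t. norm (T t - g t) \<le> e)"
proof -
  obtain p where p: "polynomial_function p" "\<And>z. z \<in> sphere 0 1 \<Longrightarrow> norm (g (Arg2pi z) - p z) < e"
    using Stone_Weierstrass_polynomial_function[OF compact_sphere circle_periodic_continuous[OF assms(1,2)] assms(3)]
    by blast
  have "norm (p (cis t) - g t) \<le> e" for t
  proof -
    have "g (Arg2pi (cis t)) = g t"
      using assms(1) cis_Arg2pi[of "cis t"] unfolding circle_periodic_def by (metis norm_cis)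
    then show ?thesis using p(2)[of "cis t"] by (simp add: norm_minus_commute)
  qed
  with trig_poly_polynomial_function[OF p(1)] show ?thesis by blast
qed

lemma norm_diff_le_of_vector_derivative:
  fixes f :: "real \<Rightarrow> complex"
  assumes "\<And>t. (f has_vector_derivative f' t) (at t)" "\<And>t. norm (f' t) \<le> B"
  shows "norm (f x - f y) \<le> B * \<bar>x - y\<bar>"
proof -
  have "norm (f x - f y) \<le> B * norm (x - y)"
  proof (rule differentiable_bound[of UNIV f "\<lambda>t h. h *\<^sub>R f' t"])
    show "onorm (\<lambda>h. h *\<^sub>R f' t) \<le> B" for t
      using assms(2)[of t] by (intro onorm_le) (simp add: mult.commute[of B] mult_left_mono)
  qed (use assms(1) in \<open>auto simp: has_vector_derivative_def\<close>)
  then show ?thesis by simp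
qed

lemma norm_funpow_vderiv_const_le: "norm ((vderiv ^^ k) (\<lambda>t. c) t) \<le> norm c"
proof -
  have "(vderiv ^^ k) (\<lambda>t. c) = (if k = 0 then \<lambda>t. c else (\<lambda>t. 0))"
    by (rule funpow_vderiv_eqI[of "\<lambda>k. if k = 0 then \<lambda>t. c else (\<lambda>t. 0)"]) auto
  then show ?thesis by simp
qed

text \<open>
  A primitive of a trigonometric polynomial close to \<open>g'\<close> is, after subtracting the mean, a
  trigonometric polynomial close to \<open>g\<close>: the mean is small because \<open>g'\<close> has mean zero.
\<close>

lemma trig_poly_dense_smooth:
  assumes "smooth_real g" "circle_periodic g" "0 < e"
  shows "\<exists>T. trig_poly T \<and> (\<forall>i\<le>k. \<forall>t. norm ((vderiv ^^ i) T t - (vderiv ^^ i) g t) \<le> e)"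
  using assms
proof (induction k arbitrary: g e)
  case 0
  then show ?case using trig_poly_dense_uniform[of g e] smooth_real_continuous[of g] by simp
next
  case (Suc k)
  \<comment> \<open>The derivative will be off by at most \<open>2 * d\<close>: once
    \<open>d\<close> from \<open>S\<close> and once from the mean \<open>c\<close>. Integrating this
    over a length of at most 2 pi gives \<open>e\<close>.\<close>
  define d where "d = e / (4 * pi)"
  have d: "0 < d" "2 * d \<le> e" "2 * d * (2 * pi) = e"
    using \<open>0 < e\<close> pi_gt3 by (auto simp: d_def field_simps)
  obtain S where S: "trig_poly S" "\<And>i t. i \<le> k \<Longrightarrow> norm ((vderiv ^^ i) S t - (vderiv ^^ i) (vderiv g) t) \<le> d"
    using Suc.IH[OF smooth_real_vderiv[OF Suc.prems(1)] circle_periodic_vderiv[OF Suc.prems(2)] d(1)]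
    by blast
  obtain U c where U: "trig_poly U" "\<And>t. (U has_vector_derivative S t - c) (at t)"
    using trig_poly_antiderivative[OF S(1)] by blast
  note dg = smooth_real_imp_deriv[OF Suc.prems(1)]
  have c: "norm c \<le> d"
  proof -
    have "((\<lambda>t. t *\<^sub>R c) has_vector_derivative c) (at t)" for t
      by (simp add: has_vector_derivative_def bounded_linear_imp_has_derivative bounded_linear_scaleR_left)
    \<comment> \<open>With \<open>t *\<^sub>R c\<close> added back the derivative is within
      \<open>d\<close> of zero, while \<open>U - g\<close> has equal values at 0 and 2 pi; the
      increment over the period is therefore 2 pi times \<open>c\<close>.\<close>
    from has_vector_derivative_add[OF has_vector_derivative_diff[OF U(2) dg] this]
    have "((\<lambda>t. U t - g t + t *\<^sub>R c) has_vector_derivative S t - vderiv g t) (at t)" for t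
      by (simp add: algebra_simps)
    then have "norm ((U (2*pi) - g (2*pi) + (2*pi) *\<^sub>R c) - (U 0 - g 0 + 0 *\<^sub>R c)) \<le> d * \<bar>2*pi - 0\<bar>"
      using S(2)[of 0] by (intro norm_diff_le_of_vector_derivative) auto
    moreover have "cis (2*pi) = cis 0" by simp
    then have "U (2*pi) = U 0" "g (2*pi) = g 0"
      using trig_poly_periodic[OF U(1)] Suc.prems(2) unfolding circle_periodic_def by blast+
    ultimately show ?thesis by (simp add: norm_mult)
  qed
  \<comment> \<open>The constant makes \<open>T\<close> and \<open>g\<close> agree at 0, where the
    integration of the derivative starts.\<close>
  define T where "T t = U t + (g 0 - U 0)" for t
  have T: "trig_poly T" unfolding T_def by (intro trig_poly_add U trig_poly_const)
  have dT: "(T has_vector_derivative S t - c) (at t)" for t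
    unfolding T_def using has_vector_derivative_add[OF U(2) has_vector_derivative_const] by simp
  have "norm (T t - g t) \<le> e" for t
  proof -
    \<comment> \<open>Periodicity moves the point into [0, 2 pi], where its distance to 0 is
      bounded.\<close>
    define s where "s = Arg2pi (cis t)"
    have s: "0 \<le> s" "s \<le> 2 * pi" "cis s = cis t"
      using Arg2pi_ge_0[of "cis t"] Arg2pi_lt_2pi[of "cis t"] by (auto simp: s_def cis_Arg2pi)
    have "((\<lambda>t. T t - g t) has_vector_derivative (S x - vderiv g x) - c) (at x)" for x
      using has_vector_derivative_diff[OF dT dg, of x] by (simp add: algebra_simps)
    moreover have "norm ((S x - vderiv g x) - c) \<le> 2 * d" for x
      using norm_triangle_ineq4[of "S x - vderiv g x" c] S(2)[of 0 x] c by simp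
    ultimately have "norm ((T s - g s) - (T 0 - g 0)) \<le> 2 * d * \<bar>s - 0\<bar>"
      by (rule norm_diff_le_of_vector_derivative)
    also have "\<dots> \<le> 2 * d * (2 * pi)" using s d by (intro mult_left_mono) auto
    finally have "norm (T s - g s) \<le> e" using d by (simp add: T_def)
    moreover have "T s = T t" "g s = g t"
      using trig_poly_periodic[OF T] Suc.prems(2) s(3) unfolding circle_periodic_def by blast+
    ultimately show ?thesis by simp
  qed
  moreover have "norm ((vderiv ^^ Suc i) T t - (vderiv ^^ Suc i) g t) \<le> e" if "i \<le> k" for i t
  proof -
    have "vderiv T = (\<lambda>t. S t - c)" by (intro vderiv_eqI dT)
    then have "(vderiv ^^ Suc i) T t = (vderiv ^^ i) S t - (vderiv ^^ i) (\<lambda>t. c) t"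
      by (simp add: funpow_Suc_right funpow_vderiv_diff[OF trig_poly_smooth[OF S(1)] trig_poly_smooth[OF trig_poly_const]]
          del: funpow.simps)
    then have "norm ((vderiv ^^ Suc i) T t - (vderiv ^^ Suc i) g t)
        = norm ((vderiv ^^ i) S t - (vderiv ^^ i) (vderiv g) t - (vderiv ^^ i) (\<lambda>t. c) t)"
      unfolding funpow_Suc_right o_apply by (simp only: diff_diff_eq add.commute)
    also have "\<dots> \<le> d + norm c"
      using S(2)[OF that, of t] norm_funpow_vderiv_const_le[of i c t]
        norm_triangle_ineq4[of "(vderiv ^^ i) S t - (vderiv ^^ i) (vderiv g) t" "(vderiv ^^ i) (\<lambda>t. c) t"] by linarith
    finally show ?thesis using c d by linarith
  qed
  ultimately have "\<forall>i\<le>Suc k. \<forall>t. norm ((vderiv ^^ i) T t - (vderiv ^^ i) g t) \<le> e"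
    by (metis Suc_le_mono funpow_0 not0_implies_Suc)
  with T show ?case by blast
qed

subsection \<open>A criterion for pluripolar graphs\<close>

text \<open>Add up functions \<open>U j\<close> with weights \<open>(1/2) ^ Suc j\<close>. The
  common majorant turns the partial sums into a decreasing sequence; its limit is
  \<open>-\<infinity>\<close> on \<open>K\<close> and nonnegative at \<open>x0\<close>.\<close>

lemma pluripolarI_cont_psh:
  fixes K :: "(complex ^ 'n) set"
  assumes \<phi>: "cont_psh \<phi>" "\<And>x. 0 \<le> \<phi> x"
    and ex: "\<And>n::nat. \<exists>u. cont_psh u \<and> (\<forall>x. u x \<le> \<phi> x) \<and> (\<forall>x\<in>K. u x \<le> - real n) \<and> 0 \<le> u x0"
  shows "pluripolar K"
proof -
  \<comment> \<open>The bound \<open>- real (2 ^ Suc j)\<close> cancels the weight, so each summand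
    is at most -1 on \<open>K\<close>.\<close>
  have "\<forall>j. \<exists>u. cont_psh u \<and> (\<forall>x. u x \<le> \<phi> x) \<and> (\<forall>x\<in>K. u x \<le> - real (2 ^ Suc j)) \<and> 0 \<le> u x0"
    using ex by blast
  then obtain U where "\<forall>j. cont_psh (U j) \<and> (\<forall>x. U j x \<le> \<phi> x) \<and> (\<forall>x\<in>K. U j x \<le> - real (2 ^ Suc j)) \<and> 0 \<le> U j x0"
    by metis
  then have U: "cont_psh (U j)" "U j x \<le> \<phi> x" "x \<in> K \<Longrightarrow> U j x \<le> - (2 ^ Suc j)" "0 \<le> U j x0" for j x
    by auto
  \<comment> \<open>The weights from index \<open>n\<close> on sum to \<open>(1/2) ^ n\<close>, so
    the first term bounds all summands still to come and \<open>v\<close> decreases.\<close>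
  define v where "v n x = (1/2) ^ n * \<phi> x + (\<Sum>j<n. (1/2) ^ Suc j * U j x)" for n x
  have psh: "cont_psh (v n)" for n
    unfolding v_def[abs_def]
    by (intro cont_psh_add cont_psh_cmult cont_psh_sum \<phi> U) auto
  have dec: "v (Suc n) x \<le> v n x" for n x
  proof -
    have "v (Suc n) x = v n x + (1/2) ^ Suc n * (U n x - \<phi> x)"
      by (simp add: v_def field_simps)
    moreover have "(1/2) ^ Suc n * (U n x - \<phi> x) \<le> 0"
      using U(2)[of n x] by (simp add: mult_nonneg_nonpos)
    ultimately show ?thesis by linarith
  qed
  define u where "u x = (INF n. ereal (v n x))" for x
  have "plurisubharmonic u"
    unfolding u_def[abs_def] by (rule plurisubharmonic_INF[where v = v, OF psh dec])
  moreover have "0 \<le> u x0"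
    unfolding u_def v_def using \<phi>(2) U(4) by (intro INF_greatest) (auto intro!: add_nonneg_nonneg sum_nonneg)
  then have "u x0 \<noteq> -\<infinity>" by auto
  moreover have "u x = -\<infinity>" if "x \<in> K" for x
  proof (rule ereal_bot)
    fix B :: real
    obtain n :: nat where n: "\<phi> x - B < real n" using reals_Archimedean2 by blast
    have "(\<Sum>j<n. (1/2) ^ Suc j * U j x) \<le> (\<Sum>j<n. - 1)"
    proof (rule sum_mono)
      fix j
      have "(1/2) ^ Suc j * U j x \<le> (1/2) ^ Suc j * - (2 ^ Suc j)"
        using U(3)[OF that, of j] by (intro mult_left_mono) auto
      then show "(1/2) ^ Suc j * U j x \<le> -1" by (simp add: power_divide)
    qed
    moreover have "(1/2) ^ n * \<phi> x \<le> 1 * \<phi> x"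
      using \<phi>(2) by (intro mult_right_mono) (auto simp: power_le_one)
    ultimately have "v n x \<le> B" using n by (simp add: v_def)
    moreover have "u x \<le> ereal (v n x)" unfolding u_def by (rule INF_lower) simp
    ultimately show "u x \<le> ereal B" by (meson ereal_less_eq(3) order_trans)
  qed
  ultimately show ?thesis unfolding pluripolar_def by blast
qed

text \<open>A power of \<open>cis t\<close> clears the negative frequencies; for a sum the two
  powers are multiplied.\<close>

lemma trig_poly_imp_poly:
  "trig_poly T \<Longrightarrow> \<exists>N q. \<forall>t. cis t ^ N * T t = poly q (cis t)"
proof (induction rule: trig_poly.induct)
  case (trig_poly_monom a n)
  show ?case
  proof (cases "0 \<le> n")
    case True
    then have "cis t ^ nat n = cis (of_int n * t)" for t
      by (subst Complex.DeMoivre) simp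
    then have "cis t ^ 0 * (a * cis (of_int n * t)) = poly (monom a (nat n)) (cis t)" for t
      by (simp add: poly_monom)
    then show ?thesis by blast
  next
    case False
    have "cis t ^ nat (- n) * (a * cis (of_int n * t)) = poly [:a:] (cis t)" for t
    proof -
      have "cis t ^ nat (- n) * cis (of_int n * t) = 1"
        using False by (subst Complex.DeMoivre) (simp add: cis_mult)
      then show ?thesis by (simp add: mult.left_commute)
    qed
    then show ?thesis by blast
  qed
next
  case (trig_poly_add S T)
  then obtain M p N q where "\<And>t. cis t ^ M * S t = poly p (cis t)" "\<And>t. cis t ^ N * T t = poly q (cis t)"
    by blast
  then have "cis t ^ (M + N) * (S t + T t) = poly (monom 1 N * p + monom 1 M * q) (cis t)" for t
    by (simp add: poly_monom power_add algebra_simps flip: \<open>\<And>t. _ = poly p (cis t)\<close> \<open>\<And>t. _ = poly q (cis t)\<close>)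
  then show ?case by blast
qed

lemma norm_poly_le_power:
  fixes p :: "complex poly"
  shows "\<exists>C D. 0 \<le> C \<and> (\<forall>z. norm (poly p z) \<le> C * max (norm z) 1 ^ D)"
proof (induction p)
  case 0
  then show ?case by (intro exI[of _ 0]) auto
next
  case (pCons a p)
  then obtain C D where CD: "0 \<le> C" "\<And>z. norm (poly p z) \<le> C * max (norm z) 1 ^ D" by blast
  have "norm (poly (pCons a p) z) \<le> (norm a + C) * max (norm z) 1 ^ Suc D" for z
  proof -
    have "norm (poly (pCons a p) z) \<le> norm a + norm z * norm (poly p z)"
      using norm_triangle_ineq[of a "z * poly p z"] by (simp add: norm_mult)
    also have "\<dots> \<le> norm a * max (norm z) 1 ^ Suc D + max (norm z) 1 * (C * max (norm z) 1 ^ D)"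
    proof (intro add_mono mult_mono CD)
      have "1 \<le> max (norm z) 1 ^ Suc D" by (intro one_le_power) auto
      then show "norm a \<le> norm a * max (norm z) 1 ^ Suc D"
        by (simp add: mult_le_cancel_left1 del: power_Suc)
    qed auto
    finally show ?thesis by (simp add: algebra_simps)
  qed
  then show ?case using CD(1) by (intro exI[of _ "norm a + C"] exI[of _ "Suc D"]) auto
qed

text \<open>A common majorant for the normalised logarithms of all polynomials used; the summand 1
  absorbs the coefficients.\<close>

definition growth :: "complex ^ 2 \<Rightarrow> real" where
  "growth x = 1 + (ln (max (norm (x $ 1)) 1) + ln (max (norm (x $ 2)) 1))"

lemma growth_nonneg: "0 \<le> growth x"
  by (simp add: growth_def)

lemma cont_psh_growth: "cont_psh growth"
  unfolding growth_def[abs_def]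
  by (intro cont_psh_add cont_psh_const cont_psh_ln_max_norm) (auto intro!: continuous_intros holomorphic_intros)

text \<open>
  The function is \<open>ln (max \<bar>z ^ N * w - q z\<bar> (exp (- d * A))) / d\<close>, where \<open>z ^ N * T = q z\<close> on the circle
  and \<open>d\<close> is large compared with the degree and the coefficients of \<open>q\<close>.
\<close>

lemma cont_psh_small_near_trig_poly:
  assumes T: "trig_poly T" and "0 \<le> A"
  shows "\<exists>\<epsilon>>0. \<forall>f R. (\<forall>t. norm (f (cis t) - T t) \<le> \<epsilon>) \<longrightarrow> norm (f 1) + 2 \<le> R \<longrightarrow>
    (\<exists>u. cont_psh u \<and> (\<forall>x. u x \<le> growth x) \<and> (\<forall>x\<in>circle_graph f. u x \<le> - A) \<and>
         0 \<le> u (vector [1, of_real R]))"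
proof -
  obtain N q where q: "\<And>t. cis t ^ N * T t = poly q (cis t)" using trig_poly_imp_poly[OF T] by blast
  obtain C D where CD: "0 \<le> C" "\<And>z. norm (poly q z) \<le> C * max (norm z) 1 ^ D"
    using norm_poly_le_power by blast
  define F where "F x = x $ 1 ^ N * x $ 2 - poly q (x $ 1)" for x :: "complex ^ 2"
  \<comment> \<open>After division by \<open>d\<close> the constant \<open>ln (1 + C)\<close> and
    the degree \<open>N + D\<close> both contribute at most 1. The successor ensures that
    \<open>d\<close> is at least 1, which handles the factor \<open>z\<close> in the second
    variable.\<close>
  obtain d0 :: nat where "max (ln (1 + C)) (real (N + D)) < d0" using reals_Archimedean2 by blast
  define d where "d = Suc d0"
  have d: "0 < d" "ln (1 + C) \<le> d" "N + D \<le> d" "1 \<le> real d"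
    using \<open>_ < real d0\<close> by (auto simp: d_def)
  \<comment> \<open>The truncation level has \<open>ln \<delta> / d = - A\<close>; it also serves as
    the tolerance for \<open>f\<close>.\<close>
  define \<delta> where "\<delta> = exp (- d * A)"
  have \<delta>: "0 < \<delta>" "\<delta> \<le> 1" using \<open>0 \<le> A\<close> by (auto simp: \<delta>_def)
  define u where "u x = (1 / d) * ln (max (norm (F x)) \<delta>)" for x
  have psh: "cont_psh u"
    unfolding u_def[abs_def]
  proof (intro cont_psh_cmult cont_psh_ln_max_norm \<delta>)
    show "continuous_on UNIV F"
      unfolding F_def[abs_def] by (intro continuous_intros)
    show "(\<lambda>\<zeta>. F (a + \<zeta> *s b)) holomorphic_on UNIV" for a b
      unfolding F_def by simp (intro holomorphic_intros)
  qed simp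
  have growth: "u x \<le> growth x" for x
  proof -
    define y z where "y = max (norm (x $ 1)) 1" and "z = max (norm (x $ 2)) 1"
    have yz: "1 \<le> y" "1 \<le> z" by (auto simp: y_def z_def)
    have "norm (F x) \<le> norm (x $ 1) ^ N * norm (x $ 2) + norm (poly q (x $ 1))"
      unfolding F_def using norm_triangle_ineq4 by (metis norm_mult norm_power)
    also have "\<dots> \<le> y ^ (N + D) * z + C * (y ^ (N + D) * z)"
    proof (intro add_mono mult_mono order_trans[OF CD(2)] CD(1))
      have "norm (x $ 1) ^ N \<le> y ^ N" by (intro power_mono) (auto simp: y_def)
      also have "y ^ N \<le> y ^ (N + D)" using yz by (intro power_increasing) auto
      finally show "norm (x $ 1) ^ N \<le> y ^ (N + D)" .
      have "max (norm (x $ 1)) 1 ^ D \<le> y ^ (N + D)"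
        unfolding y_def[symmetric] using yz by (intro power_increasing) auto
      also have "\<dots> \<le> y ^ (N + D) * z" using yz by (simp add: mult_le_cancel_left1)
      finally show "max (norm (x $ 1)) 1 ^ D \<le> y ^ (N + D) * z" .
    qed (use yz in \<open>auto simp: z_def\<close>)
    also have "\<dots> = (1 + C) * y ^ (N + D) * z" by (simp add: algebra_simps)
    finally have "norm (F x) \<le> (1 + C) * y ^ (N + D) * z" .
    moreover have "1 \<le> (1 + C) * y ^ (N + D) * z"
    proof -
      have "1 * 1 * 1 \<le> (1 + C) * y ^ (N + D) * z"
        using yz CD(1) by (intro mult_mono) (auto intro: one_le_power)
      then show ?thesis by simp
    qed
    ultimately have "ln (max (norm (F x)) \<delta>) \<le> ln ((1 + C) * y ^ (N + D) * z)"
      using \<delta> by (intro ln_mono) (auto simp: less_max_iff_disj)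
    also have "\<dots> = ln (1 + C) + real (N + D) * ln y + ln z"
      using yz CD(1) by (simp add: ln_mult ln_realpow)
    also have "\<dots> \<le> real d * 1 + real d * ln y + real d * ln z"
    proof (intro add_mono mult_right_mono)
      show "ln z \<le> real d * ln z"
        using d yz by (simp add: mult_le_cancel_right1)
    qed (use d yz in auto)
    also have "\<dots> = real d * growth x"
      by (simp add: growth_def y_def z_def algebra_simps)
    finally show ?thesis using d(1) by (simp add: u_def field_simps)
  qed
  have main: "(\<forall>x\<in>circle_graph f. u x \<le> - A) \<and> 0 \<le> u (vector [1, of_real R])"
    if f: "\<And>t. norm (f (cis t) - T t) \<le> \<delta>" and R: "norm (f 1) + 2 \<le> R" for f R
  proof (intro conjI ballI)
    fix x assume "x \<in> circle_graph f"
    then obtain z where z: "norm z = 1" "x = vector [z, f z]" by (auto simp: circle_graph_def)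
    define t where "t = Arg2pi z"
    have t: "z = cis t" using cis_Arg2pi[OF z(1)] by (simp add: t_def)
    have "F x = cis t ^ N * (f (cis t) - T t)"
      by (simp add: F_def z t q[symmetric] algebra_simps)
    then have "norm (F x) \<le> \<delta>" using f[of t] by (simp add: norm_mult norm_power)
    then have "u x = (1 / d) * ln \<delta>" by (simp add: u_def max_def)
    then show "u x \<le> - A" using d(1) by (simp add: \<delta>_def)
  next
    \<comment> \<open>Since \<open>\<delta> \<le> 1\<close>, \<open>f 1\<close> is within 1 of
      \<open>T 0\<close>; the margin 2 in \<open>R\<close> keeps \<open>R\<close> at distance at
      least 1 from \<open>T 0\<close>, where the logarithm is nonnegative.\<close>
    have "norm (T 0) \<le> norm (f 1) + 1"
      using f[of 0] \<delta> norm_triangle_ineq2[of "T 0" "f 1"] by (simp add: norm_minus_commute)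
    moreover have "R \<le> norm (of_real R - T 0) + norm (T 0)"
      using norm_triangle_ineq2[of "of_real R" "T 0"] by simp
    ultimately have "1 \<le> norm (of_real R - T 0)" using R by linarith
    moreover have "F (vector [1, of_real R]) = of_real R - T 0"
      using q[of 0] by (simp add: F_def)
    ultimately show "0 \<le> u (vector [1, of_real R])" by (simp add: u_def)
  qed
  show ?thesis
    using \<delta>(1) psh growth main by (intro exI[of _ \<delta>] conjI allI impI exI[of _ u]) auto
qed

text \<open>The tolerance depends on \<open>T\<close> and \<open>n\<close> but not on
  \<open>f\<close>, so a recursion can prescribe it before its limit exists. Once \<open>f\<close>
  is given, the point with coordinates 1 and \<open>norm (f 1) + 2\<close> serves for all
  \<open>n\<close> as the place where the functions are nonnegative.\<close>

lemma pluripolar_circle_graph_criterion: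
  "\<exists>\<epsilon> :: (real \<Rightarrow> complex) \<Rightarrow> nat \<Rightarrow> real.
     (\<forall>T n. trig_poly T \<longrightarrow> 0 < \<epsilon> T n) \<and>
     (\<forall>f. (\<forall>n. \<exists>m\<ge>n. \<exists>T. trig_poly T \<and> (\<forall>t. norm (f (cis t) - T t) \<le> \<epsilon> T m)) \<longrightarrow> pluripolar (circle_graph f))"
proof -
  define good where "good T n \<epsilon> \<longleftrightarrow> 0 < \<epsilon> \<and> (\<forall>f R. (\<forall>t. norm (f (cis t) - T t) \<le> \<epsilon>) \<longrightarrow> norm (f 1) + 2 \<le> R \<longrightarrow>
    (\<exists>u. cont_psh u \<and> (\<forall>x. u x \<le> growth x) \<and> (\<forall>x\<in>circle_graph f. u x \<le> - real n) \<and>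
         0 \<le> u (vector [1, of_real R])))" for T n and \<epsilon> :: real
  have "\<forall>T n. trig_poly T \<longrightarrow> (\<exists>e. good T n e)"
    unfolding good_def using cont_psh_small_near_trig_poly[OF _ of_nat_0_le_iff] by blast
  then obtain \<epsilon> where \<epsilon>: "\<And>T n. trig_poly T \<Longrightarrow> good T n (\<epsilon> T n)"
    by metis
  have "pluripolar (circle_graph f)"
    if f: "\<forall>n. \<exists>m\<ge>n. \<exists>T. trig_poly T \<and> (\<forall>t. norm (f (cis t) - T t) \<le> \<epsilon> T m)" for f
  proof (rule pluripolarI_cont_psh[OF cont_psh_growth growth_nonneg])
    fix n
    obtain m T where mT: "n \<le> m" "trig_poly T" "\<forall>t. norm (f (cis t) - T t) \<le> \<epsilon> T m"
      using f by blast
    then obtain u where u: "cont_psh u" "\<And>x. u x \<le> growth x" "\<And>x. x \<in> circle_graph f \<Longrightarrow> u x \<le> - real m"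
         "0 \<le> u (vector [1, of_real (norm (f 1) + 2)])"
      using \<epsilon>[OF mT(2), of m] unfolding good_def by (meson order_refl)
    have "u x \<le> - real n" if "x \<in> circle_graph f" for x
      using u(3)[OF that] mT(1) by linarith
    with u show "\<exists>u. cont_psh u \<and> (\<forall>x. u x \<le> growth x) \<and> (\<forall>x\<in>circle_graph f. u x \<le> - real n) \<and>
         0 \<le> u (vector [1, of_real (norm (f 1) + 2)])" by blast
  qed
  with \<epsilon> show ?thesis unfolding good_def by (intro exI[of _ \<epsilon>]) auto
qed

subsection \<open>The decomposition\<close>

text \<open>For fixed \<open>i\<close> the bound holds from \<open>n = i\<close> on, which is enough
  for the Weierstrass test. So each derivative converges uniformly and the limits are derivatives of
  one another.\<close>

lemma smooth_real_limit:
  assumes F: "\<And>n. smooth_real (F n)" and M: "summable M"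
    and le: "\<And>i n t. i \<le> n \<Longrightarrow> norm ((vderiv ^^ i) (F (Suc n)) t - (vderiv ^^ i) (F n) t) \<le> M n"
  shows "\<exists>h. smooth_real h \<and> (\<forall>t. (\<lambda>n. F n t) \<longlonglongrightarrow> h t)"
proof -
  define L where "L i t = (vderiv ^^ i) (F 0) t +
    (\<Sum>n. (vderiv ^^ i) (F (Suc n)) t - (vderiv ^^ i) (F n) t)" for i t
  have unif: "uniform_limit UNIV (\<lambda>n. (vderiv ^^ i) (F n)) (L i) sequentially" for i
  proof -
    have "\<forall>\<^sub>F n in sequentially. \<forall>t\<in>UNIV. norm ((vderiv ^^ i) (F (Suc n)) t - (vderiv ^^ i) (F n) t) \<le> M n"
      using eventually_ge_at_top[of i] by eventually_elim (use le in auto)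
    then have "uniform_limit UNIV (\<lambda>n t. \<Sum>j<n. (vderiv ^^ i) (F (Suc j)) t - (vderiv ^^ i) (F j) t)
        (\<lambda>t. \<Sum>n. (vderiv ^^ i) (F (Suc n)) t - (vderiv ^^ i) (F n) t) sequentially"
      using M by (rule Weierstrass_m_test_ev)
    then have "uniform_limit UNIV (\<lambda>n t. (vderiv ^^ i) (F 0) t + ((vderiv ^^ i) (F n) t - (vderiv ^^ i) (F 0) t)) (L i) sequentially"
      unfolding L_def[abs_def] sum_lessThan_telescope[of "\<lambda>n. (vderiv ^^ i) (F n) t" for t]
      by (intro uniform_limit_intros)
    then show ?thesis by simp
  qed
  have lim: "(\<lambda>n. (vderiv ^^ i) (F n) t) \<longlonglongrightarrow> L i t" for i t
    using tendsto_uniform_limitI[OF unif] by blast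
  have "(L i has_vector_derivative L (Suc i) t) (at t)" for i t
  proof -
    have "\<exists>g. \<forall>t\<in>UNIV. (\<lambda>n. (vderiv ^^ i) (F n) t) \<longlonglongrightarrow> g t \<and> (g has_derivative (\<lambda>h. h *\<^sub>R L (Suc i) t)) (at t within UNIV)"
    proof (rule has_derivative_sequence[where f' = "\<lambda>n t h. h *\<^sub>R (vderiv ^^ Suc i) (F n) t"])
      show "((vderiv ^^ i) (F n) has_derivative (\<lambda>h. h *\<^sub>R (vderiv ^^ Suc i) (F n) t)) (at t within UNIV)" for n t
        using smooth_real_funpow_vderiv[OF F] unfolding has_vector_derivative_def by blast
      show "\<forall>\<^sub>F n in sequentially. \<forall>t\<in>UNIV. \<forall>h. norm (h *\<^sub>R (vderiv ^^ Suc i) (F n) t - h *\<^sub>R L (Suc i) t) \<le> e * norm h"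
        if "0 < e" for e
        using uniform_limitD[OF unif[of "Suc i"] that]
      proof eventually_elim
        case (elim n)
        have "norm (h *\<^sub>R (vderiv ^^ Suc i) (F n) t - h *\<^sub>R L (Suc i) t) \<le> e * norm h" for h t
        proof -
          have "norm (h *\<^sub>R (vderiv ^^ Suc i) (F n) t - h *\<^sub>R L (Suc i) t)
              = norm h * norm ((vderiv ^^ Suc i) (F n) t - L (Suc i) t)"
            by (simp only: scaleR_diff_right[symmetric] norm_scaleR real_norm_def)
          also have "\<dots> \<le> norm h * e"
            using elim by (intro mult_left_mono) (auto simp: dist_norm less_imp_le)
          finally show ?thesis by (simp add: mult.commute)
        qed
        then show ?case by blast
      qed
    qed (use lim in auto)
    then obtain g where g: "\<And>t. (\<lambda>n. (vderiv ^^ i) (F n) t) \<longlonglongrightarrow> g t"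
      "\<And>t. (g has_derivative (\<lambda>h. h *\<^sub>R L (Suc i) t)) (at t)" by auto
    \<comment> \<open>The differentiable limit comes from an existence statement; uniqueness of
      pointwise limits identifies it with \<open>L i\<close>.\<close>
    have "g = L i" using LIMSEQ_unique[OF g(1) lim] by blast
    with g(2) show ?thesis by (simp add: has_vector_derivative_def)
  qed
  then have "smooth_real (L 0)" by (intro smooth_realI[of L]) auto
  moreover have "(\<lambda>n. F n t) \<longlonglongrightarrow> L 0 t" for t using lim[of 0 t] by simp
  ultimately show ?thesis by blast
qed

text \<open>Dependent choice on pairs of a polynomial and a tolerance: \<open>\<eta> (Suc m)\<close>
  is fixed after \<open>S m\<close>, so it may depend on \<open>\<epsilon> (S m) m\<close>.\<close>

lemma alternating_approximation:
  assumes g: "smooth_real g" "circle_periodic g"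
    and \<epsilon>: "\<And>T n. trig_poly T \<Longrightarrow> 0 < \<epsilon> T n"
  shows "\<exists>S \<eta>. (\<forall>m. trig_poly (S m) \<and> 0 < \<eta> m \<and> \<eta> (Suc m) \<le> \<eta> m / 2 \<and> 4 * \<eta> (Suc m) \<le> \<epsilon> (S m) m \<and>
    (\<forall>i\<le>Suc m. \<forall>t. norm ((vderiv ^^ i) (S (Suc m)) t + (vderiv ^^ i) (S m) t - (vderiv ^^ i) g t) \<le> \<eta> (Suc m)))"
proof -
  define Q where "Q m x y \<longleftrightarrow> snd y \<le> snd x / 2 \<and> 4 * snd y \<le> \<epsilon> (fst x) m \<and>
    (\<forall>i\<le>Suc m. \<forall>t. norm ((vderiv ^^ i) (fst y) t + (vderiv ^^ i) (fst x) t - (vderiv ^^ i) g t) \<le> snd y)"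
    for m and x y :: "(real \<Rightarrow> complex) \<times> real"
  have "\<exists>f. \<forall>m. (trig_poly (fst (f m)) \<and> 0 < snd (f m)) \<and> Q m (f m) (f (Suc m))"
  proof (rule dependent_nat_choice)
    show "\<exists>x. trig_poly (fst x) \<and> (0::real) < snd x"
      by (intro exI[of _ "(\<lambda>t. 0, 1)"]) (auto intro: trig_poly_const)
    fix x :: "(real \<Rightarrow> complex) \<times> real" and m
    assume x: "trig_poly (fst x) \<and> 0 < snd x"
    define e where "e = min (snd x / 2) (\<epsilon> (fst x) m / 4)"
    have "0 < e" using x \<epsilon> by (simp add: e_def)
    then obtain T where T: "trig_poly T" "\<And>i t. i \<le> Suc m \<Longrightarrow> norm ((vderiv ^^ i) T t - (vderiv ^^ i) g t) \<le> e"
      using trig_poly_dense_smooth[OF g \<open>0 < e\<close>, of "Suc m"] by blast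
    \<comment> \<open>Subtracting the previous polynomial makes the sum of neighbours equal to
      \<open>T\<close>, which is close to \<open>g\<close>.\<close>
    let ?y = "(\<lambda>t. T t - fst x t, e)"
    have "trig_poly (fst ?y)" using T x by (simp add: trig_poly_diff)
    moreover have "Q m x ?y"
      using T x by (auto simp: Q_def e_def funpow_vderiv_diff trig_poly_smooth)
    ultimately show "\<exists>y. (trig_poly (fst y) \<and> 0 < snd y) \<and> Q m x y"
      using \<open>0 < e\<close> by (intro exI[of _ ?y]) auto
  qed
  then obtain f where "\<And>m. (trig_poly (fst (f m)) \<and> 0 < snd (f m)) \<and> Q m (f m) (f (Suc m))" by blast
  then show ?thesis
    unfolding Q_def by (intro exI[of _ "\<lambda>m. fst (f m)"] exI[of _ "\<lambda>m. snd (f m)"]) auto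
qed

lemma halving_le_geometric:
  fixes e :: "nat \<Rightarrow> real"
  assumes "\<And>n. e (Suc n) \<le> e n / 2"
  shows "e n \<le> e 0 * (1/2) ^ n"
proof (induction n)
  case (Suc n)
  have "e (Suc n) \<le> e n / 2" by (rule assms)
  also have "\<dots> \<le> e 0 * (1/2) ^ n / 2" using Suc by simp
  finally show ?case by simp
qed simp

text \<open>The difference of \<open>S (m + 2)\<close> and \<open>S m\<close> is a difference of two
  neighbour sums, each close to \<open>g\<close>, so \<open>g\<close> cancels. The increments at
  least halve at each step, and the whole tail is at most twice its first bound.\<close>

lemma every_second_limit:
  assumes S: "\<And>m. smooth_real (S m)" and \<eta>: "\<And>m. 0 < \<eta> m" "\<And>m. \<eta> (Suc m) \<le> \<eta> m / 2"
    and close: "\<And>m i t. i \<le> Suc m \<Longrightarrow>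
      norm ((vderiv ^^ i) (S (Suc m)) t + (vderiv ^^ i) (S m) t - (vderiv ^^ i) g t) \<le> \<eta> (Suc m)"
  shows "\<exists>h. smooth_real h \<and> (\<forall>t. (\<lambda>j. S (2 * j + p) t) \<longlonglongrightarrow> h t) \<and>
    (\<forall>j t. norm (h t - S (2 * j + p) t) \<le> 4 * \<eta> (Suc (2 * j + p)))"
proof -
  define F where "F j = S (2 * j + p)" for j
  define e where "e j = 2 * \<eta> (Suc (2 * j + p))" for j
  have e0: "0 < e j" for j using \<eta>(1) by (simp add: e_def)
  have e_half: "e (Suc j) \<le> e j / 2" for j
    using \<eta>(2)[of "Suc (2 * j + p)"] \<eta>(2)[of "Suc (Suc (2 * j + p))"] \<eta>(1)[of "Suc (2 * j + p)"]
    by (simp add: e_def)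
  have step: "norm ((vderiv ^^ i) (F (Suc j)) t - (vderiv ^^ i) (F j) t) \<le> e j" if "i \<le> j" for i j t
  proof -
    let ?m = "2 * j + p"
    let ?A = "(vderiv ^^ i) (S (Suc (Suc ?m))) t + (vderiv ^^ i) (S (Suc ?m)) t - (vderiv ^^ i) g t"
    let ?B = "(vderiv ^^ i) (S (Suc ?m)) t + (vderiv ^^ i) (S ?m) t - (vderiv ^^ i) g t"
    have "(vderiv ^^ i) (F (Suc j)) t - (vderiv ^^ i) (F j) t = ?A - ?B"
      by (simp add: F_def)
    then have "norm ((vderiv ^^ i) (F (Suc j)) t - (vderiv ^^ i) (F j) t) \<le> norm ?A + norm ?B"
      using norm_triangle_ineq4[of ?A ?B] by simp
    also have "\<dots> \<le> \<eta> (Suc (Suc ?m)) + \<eta> (Suc ?m)"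
      using that by (intro add_mono close) auto
    finally show ?thesis using \<eta>(2)[of "Suc ?m"] \<eta>(1)[of "Suc ?m"] by (simp add: e_def)
  qed
  have "e j \<le> e 0 * (1/2) ^ j" for j
    using e_half by (rule halving_le_geometric)
  then have "summable e"
    using e0 by (intro summable_comparison_test'[OF summable_mult[OF summable_geometric, of "1/2" "e 0"], of 0])
      (auto simp: abs_of_pos)
  then obtain h where h: "smooth_real h" "\<And>t. (\<lambda>j. F j t) \<longlonglongrightarrow> h t"
    using smooth_real_limit[of F e] step S unfolding F_def by blast
  \<comment> \<open>The subtracted term makes the induction close: \<open>e (j + n)\<close> is at
    most \<open>2 * e (j + n) - 2 * e (j + Suc n)\<close>.\<close>
  have "norm (F (j + n) t - F j t) \<le> 2 * e j - 2 * e (j + n)" for j n t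
  proof (induction n)
    case (Suc n)
    have "norm (F (j + Suc n) t - F j t) \<le> norm (F (Suc (j + n)) t - F (j + n) t) + norm (F (j + n) t - F j t)"
      using norm_triangle_ineq[of "F (Suc (j + n)) t - F (j + n) t" "F (j + n) t - F j t"] by simp
    then show ?case using Suc step[of 0 "j + n" t] e_half[of "j + n"] by simp
  qed simp
  then have "norm (F (n + j) t - F j t) \<le> 2 * e j" for j n t
    using e0[of "j + n"] by (smt (verit) add.commute)
  moreover have "(\<lambda>n. norm (F (n + j) t - F j t)) \<longlonglongrightarrow> norm (h t - F j t)" for j t
    by (intro tendsto_intros LIMSEQ_ignore_initial_segment h)
  ultimately have "norm (h t - F j t) \<le> 2 * e j" for j t
    by (meson LIMSEQ_le_const2)
  with h show ?thesis unfolding F_def e_def by (intro exI[of _ h]) auto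
qed

lemma circle_periodic_limit:
  assumes "\<And>n. circle_periodic (F n)" "\<And>t. (\<lambda>n. F n t) \<longlonglongrightarrow> h t"
  shows "circle_periodic h"
  unfolding circle_periodic_def
proof (intro allI impI)
  fix s t assume "cis s = cis t"
  then have "F n s = F n t" for n using assms(1) unfolding circle_periodic_def by blast
  then show "h s = h t" using assms(2)[of s] assms(2)[of t] LIMSEQ_unique by simp
qed

theorem corollary1p4:
  fixes f :: "complex \<Rightarrow> complex"
  assumes "smooth_on_circle f"
  shows "\<exists>f1 f2 :: complex \<Rightarrow> complex.
           smooth_on_circle f1 \<and> smooth_on_circle f2 \<and>
           (\<forall>z\<in>sphere 0 1. f z = f1 z - f2 z) \<and>
           pluripolar (circle_graph f1) \<and> pluripolar (circle_graph f2)"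
proof -
  define g where "g t = f (cis t)" for t
  have g: "smooth_real g" "circle_periodic g"
    using assms by (auto simp: smooth_on_circle_def g_def[abs_def] circle_periodic_def)
  obtain \<epsilon> :: "(real \<Rightarrow> complex) \<Rightarrow> nat \<Rightarrow> real" where \<epsilon>: "\<forall>T n. trig_poly T \<longrightarrow> 0 < \<epsilon> T n"
    "\<forall>f. (\<forall>n. \<exists>m\<ge>n. \<exists>T. trig_poly T \<and> (\<forall>t. norm (f (cis t) - T t) \<le> \<epsilon> T m)) \<longrightarrow> pluripolar (circle_graph f)"
    using pluripolar_circle_graph_criterion by blast
  \<comment> \<open>The minimum serves both signs: the second summand is the negative of a limit and
    is approximated by \<open>- S m\<close>.\<close>
  define \<epsilon>' where "\<epsilon>' T n = min (\<epsilon> T n) (\<epsilon> (\<lambda>t. - T t) n)" for T n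
  have \<epsilon>'_pos: "0 < \<epsilon>' T n" if "trig_poly T" for T n
    using \<epsilon>(1) that trig_poly_minus by (auto simp: \<epsilon>'_def)
  from alternating_approximation[where \<epsilon> = \<epsilon>', OF g \<epsilon>'_pos]
  obtain S \<eta> where S: "\<And>m. trig_poly (S m)" and \<eta>: "\<And>m. 0 < \<eta> m" "\<And>m. \<eta> (Suc m) \<le> \<eta> m / 2"
    "\<And>m. 4 * \<eta> (Suc m) \<le> \<epsilon>' (S m) m"
    and close: "\<And>m i t. i \<le> Suc m \<Longrightarrow>
      norm ((vderiv ^^ i) (S (Suc m)) t + (vderiv ^^ i) (S m) t - (vderiv ^^ i) g t) \<le> \<eta> (Suc m)"
    by blast
  have "\<exists>h. smooth_real h \<and> (\<forall>t. (\<lambda>j. S (2 * j + p) t) \<longlonglongrightarrow> h t) \<and>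
    (\<forall>j t. norm (h t - S (2 * j + p) t) \<le> 4 * \<eta> (Suc (2 * j + p)))" for p
    by (rule every_second_limit[where \<eta> = \<eta>, OF trig_poly_smooth[OF S] \<eta>(1,2) close])
  then obtain h where h: "\<And>p. smooth_real (h p)" "\<And>p t. (\<lambda>j. S (2 * j + p) t) \<longlonglongrightarrow> h p t"
    "\<And>p j t. norm (h p t - S (2 * j + p) t) \<le> 4 * \<eta> (Suc (2 * j + p))"
    by metis
  have per: "circle_periodic (h p)" for p
    by (rule circle_periodic_limit[OF trig_poly_periodic[OF S] h(2)])
  \<comment> \<open>Periodicity lets \<open>h p\<close> descend to the circle; values elsewhere are
    immaterial.\<close>
  define H where "H p z = h p (Arg2pi z)" for p z
  have H: "H p (cis t) = h p t" for p t
    using per[of p] cis_Arg2pi[of "cis t"] unfolding circle_periodic_def H_def by (metis norm_cis)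
  \<comment> \<open>The neighbour sums at indices \<open>2 * j + 1\<close> and \<open>2 * j\<close>
    tend to the sum of the limits, and also to \<open>g\<close> with error
    \<open>\<eta> (2 * j + 1)\<close>.\<close>
  have sum: "g t = h 1 t + h 0 t" for t
  proof (rule LIMSEQ_unique)
    show "(\<lambda>j. S (2 * j + 1) t + S (2 * j + 0) t) \<longlonglongrightarrow> h 1 t + h 0 t"
      by (intro tendsto_add h)
    have "\<eta> m \<le> \<eta> 0 * (1/2) ^ m" for m
      using \<eta>(2) by (rule halving_le_geometric)
    moreover have "(\<lambda>m. \<eta> 0 * (1/2) ^ m) \<longlonglongrightarrow> \<eta> 0 * 0"
      by (intro tendsto_intros LIMSEQ_power_zero) simp
    ultimately have "\<eta> \<longlonglongrightarrow> 0"
      using \<eta>(1) by (intro tendsto_sandwich[of "\<lambda>_. 0" \<eta> _ "\<lambda>m. \<eta> 0 * (1/2) ^ m"]) (auto simp: less_imp_le)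
    then have "(\<lambda>j. \<eta> (2 * j + 1)) \<longlonglongrightarrow> 0"
      by (rule filterlim_compose) (auto intro!: filterlim_subseq strict_monoI)
    then have "(\<lambda>j. (S (2 * j + 1) t + S (2 * j + 0) t) - g t) \<longlonglongrightarrow> 0"
      by (rule Lim_null_comparison[rotated]) (use close[of 0 "2 * j" t for j] in auto)
    then show "(\<lambda>j. S (2 * j + 1) t + S (2 * j + 0) t) \<longlonglongrightarrow> g t"
      by (rule LIM_zero_cancel)
  qed
  have smooth: "smooth_on_circle (H p)" "smooth_on_circle (\<lambda>z. - H p z)" for p
    using h(1)[of p] smooth_real_minus[OF h(1)[of p]] by (simp_all add: smooth_on_circle_def H)
  have pp: "pluripolar (circle_graph (H p))" for p
  proof (rule \<epsilon>(2)[THEN spec, THEN mp], rule allI)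
    fix n
    \<comment> \<open>The recursion made \<open>4 * \<eta> (Suc m)\<close>, which bounds the
      distance of the limit from \<open>S m\<close>, at most the tolerance for \<open>S m\<close>;
      the index \<open>2 * n + p\<close> is at least \<open>n\<close>.\<close>
    have "norm (H p (cis t) - S (2 * n + p) t) \<le> \<epsilon> (S (2 * n + p)) (2 * n + p)" for t
      using h(3)[of p t n] \<eta>(3)[of "2 * n + p"] by (simp add: H \<epsilon>'_def)
    then show "\<exists>m\<ge>n. \<exists>T. trig_poly T \<and> (\<forall>t. norm (H p (cis t) - T t) \<le> \<epsilon> T m)"
      using S by (intro exI[of _ "2 * n + p"]) auto
  qed
  have pm: "pluripolar (circle_graph (\<lambda>z. - H p z))" for p
  proof (rule \<epsilon>(2)[THEN spec, THEN mp], rule allI)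
    fix n
    have "norm (- H p (cis t) - (- S (2 * n + p) t)) \<le> \<epsilon> (\<lambda>t. - S (2 * n + p) t) (2 * n + p)" for t
      using h(3)[of p t n] \<eta>(3)[of "2 * n + p"] by (simp add: H \<epsilon>'_def norm_minus_commute)
    then show "\<exists>m\<ge>n. \<exists>T. trig_poly T \<and> (\<forall>t. norm (- H p (cis t) - T t) \<le> \<epsilon> T m)"
      using trig_poly_minus[OF S]
      by (intro exI[of _ "2 * n + p"] exI[of _ "\<lambda>t. - S (2 * n + p) t"] conjI) auto
  qed
  have "f z = H 1 z - (- H 0 z)" if "z \<in> sphere 0 1" for z
    using sum[of "Arg2pi z"] that by (simp add: g_def H_def cis_Arg2pi)
  with smooth pp pm show ?thesis
    by (intro exI[of _ "H 1"] exI[of _ "\<lambda>z. - H 0 z"]) blast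
qed

end
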